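(* Suppose a simple graph $G$ on $n$ vertices admits an $\varepsilon$-factorization via $(H,K,E)$, and put $\Delta_*:=\min\{\Delta(H),\Delta(K)\}$. Then \[ \left|2e(G)-\sum_{w=1}^n d_H(w)d_K(w)\right|\le (1+\Delta_* )\|E\|_0\le (1+\Delta_* )\,\varepsilon n^2 . \] In particular, if $\varepsilon=0$, then $2e(G)=\sum_{w=1}^n d_H(w)d_K(w)$.
   Context: All graphs are finite, simple and undirected; the vertex set is identified with $[n]$ via a fixed ordering. $A(H)$ is the adjacency matrix of $H$, $d_H(w)$ is the degree of $w$ in $H$, $\Delta(H)$ is the maximum degree of $H$, $e(G)$ is the number of edges of $G$, and $\|E\|_0$ is the number of nonzero entries of $E$. Let $0\le\varepsilon\le1$. $G$ (equivalently $A(G)$) admits an $\varepsilon$-factorization via $(H,K,E)$ means: $H,K$ are simple graphs on $V(G)$, $E\in\{0,1\}^{n\times n}$ satisfies $\|E\|_0\le\varepsilon n^2$, and $(A(H)A(K))_{ij}=A(G)_{ij}$ for every $(i,j)$ with $E_{ij}=0$. *)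

theory Defs
  imports "Jordan_Normal_Form.Matrix" Complex_Main
begin

text \<open>A simple graph on \<open>n\<close> vertices is given by its set of edges, which are two-element subsets
  of the vertex set. The vertices are numbered \<open>0, \<dots>, n - 1\<close>, so that they coincide with the
  indices of an \<open>n \<times> n\<close> matrix.\<close>

definition simple_graph :: "nat \<Rightarrow> nat set set \<Rightarrow> bool" where
  "simple_graph n G \<longleftrightarrow> (\<forall>e\<in>G. e \<subseteq> {..<n} \<and> card e = 2)"

definition adj_mat :: "nat \<Rightarrow> nat set set \<Rightarrow> int mat" where
  "adj_mat n G = mat n n (\<lambda>(i, j). if {i, j} \<in> G then 1 else 0)"

definition vertex_degree :: "nat \<Rightarrow> nat set set \<Rightarrow> nat \<Rightarrow> nat" where
  "vertex_degree n G w = card {v \<in> {..<n}. {w, v} \<in> G}"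

text \<open>Inserting \<open>0\<close> only matters for \<open>n = 0\<close>, where it makes the maximum degree \<open>0\<close>.\<close>

definition max_degree :: "nat \<Rightarrow> nat set set \<Rightarrow> nat" where
  "max_degree n G = Max (insert 0 (vertex_degree n G ` {..<n}))"

definition num_edges :: "nat set set \<Rightarrow> nat" where
  "num_edges G = card G"

definition zero_norm :: "'a::zero mat \<Rightarrow> nat" where
  "zero_norm E = card {(i, j). i < dim_row E \<and> j < dim_col E \<and> E $$ (i, j) \<noteq> 0}"

definition eps_factorization ::
  "nat \<Rightarrow> real \<Rightarrow> nat set set \<Rightarrow> nat set set \<Rightarrow> nat set set \<Rightarrow> int mat \<Rightarrow> bool" where
  "eps_factorization n \<epsilon> G H K E \<longleftrightarrow>
     simple_graph n H \<and> simple_graph n K \<and>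
     E \<in> carrier_mat n n \<and> (\<forall>i<n. \<forall>j<n. E $$ (i, j) \<in> {0, 1}) \<and>
     real (zero_norm E) \<le> \<epsilon> * (real n)\<^sup>2 \<and>
     (\<forall>i<n. \<forall>j<n. E $$ (i, j) = 0 \<longrightarrow>
        (adj_mat n H * adj_mat n K) $$ (i, j) = adj_mat n G $$ (i, j))"

end

theory Submission
  imports Defs
begin

text \<open>The idea is to sum all entries of \<open>A(G)\<close> and of \<open>A(H) A(K)\<close>. The entries of
  \<open>A(G)\<close> add up to \<open>2 e(G)\<close> (handshake lemma). An entry \<open>(i, j)\<close> of \<open>A(H) A(K)\<close> counts the
  walks \<open>i - w - j\<close> with first edge in \<open>H\<close> and second edge in \<open>K\<close>; counting these walks by
  their middle vertex \<open>w\<close>, all entries together add up to \<open>\<Sum>w. d\<^sub>H(w) d\<^sub>K(w)\<close>. The two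
  matrices agree wherever \<open>E\<close> vanishes, so the difference of the two sums only receives
  contributions from the \<open>\<parallel>E\<parallel>\<^sub>0\<close> exceptional positions. At such a position the entry of \<open>A(G)\<close>
  is \<open>0\<close> or \<open>1\<close>, while the walk count lies between \<open>0\<close> and both \<open>d\<^sub>H(i)\<close> and \<open>d\<^sub>K(j)\<close>, because
  an \<open>H\<close>-neighbour of \<open>i\<close>, or a \<open>K\<close>-neighbour of \<open>j\<close>, determines the walk. Hence each
  contribution is at most \<open>1 + \<Delta>\<^sub>*\<close> in absolute value.\<close>

lemma adj_mat_index [simp]:
  "i < n \<Longrightarrow> j < n \<Longrightarrow> adj_mat n G $$ (i, j) = (if {i, j} \<in> G then 1 else 0)"
  by (simp add: adj_mat_def)

lemma adj_mat_mult_index: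
  assumes "i < n" "j < n"
  shows "(adj_mat n H * adj_mat n K) $$ (i, j) =
           (\<Sum>w<n. adj_mat n H $$ (i, w) * adj_mat n K $$ (w, j))"
  using assms by (simp add: adj_mat_def scalar_prod_def atLeast0LessThan)

lemma row_sum_adj_mat:
  assumes "w < n"
  shows "(\<Sum>j<n. adj_mat n G $$ (w, j)) = int (vertex_degree n G w)"
proof -
  have "(\<Sum>j<n. adj_mat n G $$ (w, j)) = (\<Sum>j<n. if {w, j} \<in> G then 1 else 0)"
    using assms by (intro sum.cong) auto
  also have "\<dots> = int (card {j \<in> {..<n}. {w, j} \<in> G})"
    by (simp add: sum.If_cases Int_def)
  finally show ?thesis
    by (simp add: vertex_degree_def)
qed

lemma adj_mat_symmetric:
  assumes "i < n" "j < n"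
  shows "adj_mat n G $$ (i, j) = adj_mat n G $$ (j, i)"
  using assms by (simp add: insert_commute)

lemma col_sum_adj_mat:
  assumes "w < n"
  shows "(\<Sum>i<n. adj_mat n G $$ (i, w)) = int (vertex_degree n G w)"
proof -
  have "(\<Sum>i<n. adj_mat n G $$ (i, w)) = (\<Sum>i<n. adj_mat n G $$ (w, i))"
    using assms by (intro sum.cong adj_mat_symmetric) auto
  with row_sum_adj_mat[OF assms] show ?thesis
    by simp
qed

lemma vertex_degree_le_max_degree:
  "w < n \<Longrightarrow> vertex_degree n G w \<le> max_degree n G"
  by (simp add: max_degree_def)

text \<open>Handshake lemma: the entries equal to \<open>1\<close> are the ordered pairs of adjacent vertices, and
  every edge \<open>{a, b}\<close> with \<open>a \<noteq> b\<close> gives rise to exactly the two pairs \<open>(a, b)\<close> and \<open>(b, a)\<close>.\<close>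

lemma sum_entries_adj_mat:
  assumes "simple_graph n G"
  shows "(\<Sum>(i, j)\<in>{..<n} \<times> {..<n}. adj_mat n G $$ (i, j)) = 2 * int (num_edges G)"
proof -
  define pairs :: "nat set \<Rightarrow> (nat \<times> nat) set" where "pairs = (\<lambda>e. {(i, j). {i, j} = e})"
  have "G \<subseteq> Pow {..<n}"
    using assms by (auto simp: simple_graph_def)
  then have fin: "finite G"
    by (rule finite_subset) simp
  have card_pairs: "finite (pairs e) \<and> card (pairs e) = 2" if "e \<in> G" for e
  proof -
    from assms that have "card e = 2"
      by (simp add: simple_graph_def)
    then obtain a b where "e = {a, b}" "a \<noteq> b"
      by (auto simp: card_2_iff)
    then have "pairs e = {(a, b), (b, a)}"
      by (auto simp: pairs_def doubleton_eq_iff)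
    with \<open>a \<noteq> b\<close> show ?thesis
      by simp
  qed
  have union: "{(i, j) \<in> {..<n} \<times> {..<n}. {i, j} \<in> G} = (\<Union>e\<in>G. pairs e)"
    using assms by (auto simp: pairs_def simple_graph_def)
  have "(\<Sum>(i, j)\<in>{..<n} \<times> {..<n}. adj_mat n G $$ (i, j)) =
        (\<Sum>p\<in>{..<n} \<times> {..<n}. if {fst p, snd p} \<in> G then 1 else 0)"
    by (intro sum.cong) auto
  also have "\<dots> = int (card {(i, j) \<in> {..<n} \<times> {..<n}. {i, j} \<in> G})"
    by (simp add: sum.If_cases Int_def case_prod_unfold mem_Times_iff conj_assoc)
  also have "card {(i, j) \<in> {..<n} \<times> {..<n}. {i, j} \<in> G} = (\<Sum>e\<in>G. card (pairs e))"
    unfolding union using fin card_pairs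
    by (intro card_UN_disjoint) (auto simp: pairs_def)
  also have "\<dots> = 2 * card G"
    using card_pairs by simp
  finally show ?thesis
    by (simp add: num_edges_def)
qed

text \<open>Summing over the end points \<open>i\<close> and \<open>j\<close> for a fixed middle vertex \<open>w\<close> factors into the
  column sum of \<open>A(H)\<close> and the row sum of \<open>A(K)\<close> at \<open>w\<close>.\<close>

lemma sum_entries_adj_mat_mult:
  "(\<Sum>(i, j)\<in>{..<n} \<times> {..<n}. (adj_mat n H * adj_mat n K) $$ (i, j)) =
     (\<Sum>w<n. int (vertex_degree n H w) * int (vertex_degree n K w))"
proof -
  have "(\<Sum>(i, j)\<in>{..<n} \<times> {..<n}. (adj_mat n H * adj_mat n K) $$ (i, j)) =
        (\<Sum>i<n. \<Sum>j<n. \<Sum>w<n. adj_mat n H $$ (i, w) * adj_mat n K $$ (w, j))"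
    unfolding sum.cartesian_product[symmetric]
    by (intro sum.cong refl adj_mat_mult_index) auto
  also have "\<dots> = (\<Sum>i<n. \<Sum>w<n. \<Sum>j<n. adj_mat n H $$ (i, w) * adj_mat n K $$ (w, j))"
    by (intro sum.cong refl sum.swap)
  also have "\<dots> = (\<Sum>w<n. \<Sum>i<n. \<Sum>j<n. adj_mat n H $$ (i, w) * adj_mat n K $$ (w, j))"
    by (rule sum.swap)
  also have "\<dots> = (\<Sum>w<n. (\<Sum>i<n. adj_mat n H $$ (i, w)) * (\<Sum>j<n. adj_mat n K $$ (w, j)))"
    by (simp only: sum_product)
  also have "\<dots> = (\<Sum>w<n. int (vertex_degree n H w) * int (vertex_degree n K w))"
    by (intro sum.cong refl arg_cong2[where f = "(*)"] col_sum_adj_mat row_sum_adj_mat) auto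
  finally show ?thesis .
qed

lemma adj_mat_mult_nonneg:
  assumes "i < n" "j < n"
  shows "0 \<le> (adj_mat n H * adj_mat n K) $$ (i, j)"
  unfolding adj_mat_mult_index[OF assms] using assms by (intro sum_nonneg) auto

text \<open>Dropping the condition on one of the two edges of a walk leaves the neighbours of the
  other end point; as either edge may be dropped, both maximum degrees are upper bounds.\<close>

lemma adj_mat_mult_le_max_degree:
  assumes "i < n" "j < n"
  shows "(adj_mat n H * adj_mat n K) $$ (i, j) \<le> int (min (max_degree n H) (max_degree n K))"
proof -
  have "(adj_mat n H * adj_mat n K) $$ (i, j) \<le> (\<Sum>w<n. adj_mat n H $$ (i, w))"
    unfolding adj_mat_mult_index[OF assms] using assms by (intro sum_mono) auto
  also have "\<dots> \<le> int (max_degree n H)"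
    using assms by (simp only: row_sum_adj_mat of_nat_le_iff vertex_degree_le_max_degree)
  finally have H: "(adj_mat n H * adj_mat n K) $$ (i, j) \<le> int (max_degree n H)" .
  have "(adj_mat n H * adj_mat n K) $$ (i, j) \<le> (\<Sum>w<n. adj_mat n K $$ (w, j))"
    unfolding adj_mat_mult_index[OF assms] using assms by (intro sum_mono) auto
  also have "\<dots> \<le> int (max_degree n K)"
    using assms by (simp only: col_sum_adj_mat of_nat_le_iff vertex_degree_le_max_degree)
  finally show ?thesis
    using H by simp
qed

text \<open>The entrywise differences vanish off the support of \<open>E\<close>. On the support, an entry of
  \<open>A(G)\<close> lies in \<open>[0, 1]\<close> and a walk count in \<open>[0, \<Delta>\<^sub>*]\<close>, so their difference has absolute
  value at most \<open>1 + \<Delta>\<^sub>*\<close>. Working over the integers keeps the case \<open>\<epsilon> = 0\<close> an exact identity.\<close>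

lemma num_edges_degree_product_bound:
  assumes G: "simple_graph n G"
    and E: "E \<in> carrier_mat n n"
    and agree: "\<And>i j. i < n \<Longrightarrow> j < n \<Longrightarrow> E $$ (i, j) = 0 \<Longrightarrow>
      (adj_mat n H * adj_mat n K) $$ (i, j) = adj_mat n G $$ (i, j)"
  shows "\<bar>2 * int (num_edges G) - (\<Sum>w<n. int (vertex_degree n H w) * int (vertex_degree n K w))\<bar>
           \<le> (1 + int (min (max_degree n H) (max_degree n K))) * int (zero_norm E)"
proof -
  let ?\<Delta> = "min (max_degree n H) (max_degree n K)"
  define D where
    "D = (\<lambda>(i, j). adj_mat n G $$ (i, j) - (adj_mat n H * adj_mat n K) $$ (i, j))"
  define S where "S = {(i, j). i < dim_row E \<and> j < dim_col E \<and> E $$ (i, j) \<noteq> 0}"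
  have S_sub: "S \<subseteq> {..<n} \<times> {..<n}"
    using E by (auto simp: S_def)
  have bound: "\<bar>D p\<bar> \<le> 1 + int ?\<Delta>" if pS: "p \<in> S" for p
  proof -
    obtain i j where p: "p = (i, j)" and ij: "i < n" "j < n"
      using S_sub pS by auto
    have "0 \<le> adj_mat n G $$ (i, j)" "adj_mat n G $$ (i, j) \<le> 1"
      using ij by auto
    with adj_mat_mult_nonneg[OF ij, of H K] adj_mat_mult_le_max_degree[OF ij, of H K]
    show ?thesis
      unfolding p D_def case_prod_conv by linarith
  qed
  have "2 * int (num_edges G) - (\<Sum>w<n. int (vertex_degree n H w) * int (vertex_degree n K w)) =
        (\<Sum>p\<in>{..<n} \<times> {..<n}. D p)"
    unfolding sum_entries_adj_mat[OF G, symmetric] sum_entries_adj_mat_mult[symmetric]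
      sum_subtractf[symmetric] D_def
    by (intro sum.cong) auto
  also have "\<dots> = (\<Sum>p\<in>S. D p)"
    using S_sub E agree by (intro sum.mono_neutral_right) (auto simp: D_def S_def)
  also have "\<bar>\<dots>\<bar> \<le> (\<Sum>p\<in>S. \<bar>D p\<bar>)"
    by (rule sum_abs)
  also have "\<dots> \<le> int (card S) * (1 + int ?\<Delta>)"
    using bound by (rule sum_bounded_above)
  finally show ?thesis
    by (simp add: zero_norm_def S_def mult.commute)
qed

theorem lemma4:
  fixes n :: nat and \<epsilon> :: real and G H K :: "nat set set" and E :: "int mat"
  assumes "0 \<le> \<epsilon>" and "\<epsilon> \<le> 1"
    and "simple_graph n G"
    and "eps_factorization n \<epsilon> G H K E"
  defines "\<Delta> \<equiv> min (max_degree n H) (max_degree n K)"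
  shows "\<bar>2 * real (num_edges G) - (\<Sum>w<n. real (vertex_degree n H w) * real (vertex_degree n K w))\<bar>
           \<le> (1 + real \<Delta>) * real (zero_norm E)
       \<and> (1 + real \<Delta>) * real (zero_norm E) \<le> (1 + real \<Delta>) * \<epsilon> * (real n)\<^sup>2
       \<and> (\<epsilon> = 0 \<longrightarrow> 2 * num_edges G = (\<Sum>w<n. vertex_degree n H w * vertex_degree n K w))"
proof -
  let ?d = "2 * int (num_edges G) - (\<Sum>w<n. int (vertex_degree n H w) * int (vertex_degree n K w))"
  have norm: "real (zero_norm E) \<le> \<epsilon> * (real n)\<^sup>2"
    using assms(4) by (simp add: eps_factorization_def)
  have int_bound: "\<bar>?d\<bar> \<le> (1 + int \<Delta>) * int (zero_norm E)"
    unfolding \<Delta>_def using assms(3,4)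
    by (intro num_edges_degree_product_bound) (auto simp: eps_factorization_def)
  then have "real_of_int \<bar>?d\<bar> \<le> real_of_int ((1 + int \<Delta>) * int (zero_norm E))"
    by (simp only: of_int_le_iff)
  then have first: "\<bar>2 * real (num_edges G)
      - (\<Sum>w<n. real (vertex_degree n H w) * real (vertex_degree n K w))\<bar>
      \<le> (1 + real \<Delta>) * real (zero_norm E)"
    by simp
  have second: "(1 + real \<Delta>) * real (zero_norm E) \<le> (1 + real \<Delta>) * \<epsilon> * (real n)\<^sup>2"
    unfolding mult.assoc using norm by (intro mult_left_mono) auto
  have third: "2 * num_edges G = (\<Sum>w<n. vertex_degree n H w * vertex_degree n K w)"
    if "\<epsilon> = 0"
  proof -
    from norm that have "zero_norm E = 0"
      by simp
    with int_bound have "?d = 0"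
      by simp
    then have "int (2 * num_edges G) = int (\<Sum>w<n. vertex_degree n H w * vertex_degree n K w)"
      by simp
    then show ?thesis
      by (simp only: of_nat_eq_iff)
  qed
  from first second third show ?thesis
    by blast
qed

end
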